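(* Let $L$ be an even hyperbolic lattice and let $f \in \mathrm{O}^+(L)$ have spectral radius $\tau > 1$. Let $v, w \in L \otimes \mathbb{R}$ be nonzero elements with $f(v) = \tau v$, $f(w) = \tau^{-1} w$ and $(v,w) > 0$. Let $h \in L$ be such that $h^2 > 0$. Set $$\mathcal{C} := \{ r \in L \mid r^2 = -2 \text{ and } r + f(r) + \cdots + f^i(r) = 0 \text{ for some } i \ge 1\},$$ $$\mathcal{R}_h := \{ r \in L \mid r^2 = -2 \text{ and } (r,h) = 0\},$$ $$\mathcal{S}_h := \{ r \in L \mid r^2 = -2 \text{ and } (r,h)(r,f(h)) < 0\}.$$ Then: 1) The three sets $\mathcal{C}$, $\mathcal{R}_h$, $\mathcal{S}_h$ are finite. 2) $f$ is positive if and only if both of the following conditions are satisfied: (i) $\mathcal{C}$ is empty; (ii) $(r,v)(r,w) \ge 0$ for all $r \in \mathcal{R}_h \cup \mathcal{S}_h$.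
   Context: A lattice $L$ is a finitely generated free $\mathbb{Z}$-module with a $\mathbb{Z}$-valued symmetric bilinear form $(\cdot,\cdot)$; write $x^2 = (x,x)$. $L$ is even if $x^2 \in 2\mathbb{Z}$ for all $x\in L$. $L$ is hyperbolic if it has signature $(1,n)$ with $n \ge 1$ (one positive square). A root is an element $r\in L$ with $r^2=-2$. For an even hyperbolic lattice $L$, the positive cone $\mathcal{P}$ is one (fixed) of the two connected components of $\{x \in L\otimes\mathbb{R} \mid x^2 > 0\}$, and $\mathrm{O}^+(L) \subset \mathrm{O}(L)$ is the subgroup of isometries of $L$ preserving $\mathcal{P}$. The chambers are the connected components of the complement in $\mathcal{P}$ of the union of all root hyperplanes $r^\perp = \{x \in L \otimes \mathbb{R} \mid (x,r) = 0\}$, where $r$ runs over the roots of $L$. An isometry $f \in \mathrm{O}^+(L)$ is called positive if there is a chamber $\mathcal{M} \subset \mathcal{P}$ with $f(\mathcal{M}) = \mathcal{M}$. If $f\in \mathrm{O}^+(L)$ has spectral radius $\tau>1$, then $\tau$ is a Salem number and $\tau,\tau^{-1}$ are eigenvalues of $f$ of multiplicity one; eigenvectors $v,w$ then satisfy $(v,w) \ne 0$, so the normalization $(v,w)>0$ can be achieved by replacing $v$ by $-v$ if necessary. *)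

theory Defs
  imports "HOL-Analysis.Analysis"
begin

text \<open>
  A lattice \<open>L\<close> is represented together with \<open>L \<otimes> \<real>\<close>: the type \<open>'a\<close> is the real vector space
  \<open>L \<otimes> \<real>\<close>, the set \<open>L\<close> is the integer span of a real basis of it, and \<open>B\<close> is the real bilinear
  extension of the form of the lattice. The class \<open>euclidean_space\<close> supplies finite dimension and
  the usual topology, which is needed for connected components; its inner product is
  unrelated to \<open>B\<close>.
\<close>

definition integer_span :: "'a::real_vector set \<Rightarrow> 'a set" where
  "integer_span S = {\<Sum>b\<in>S. of_int (c b) *\<^sub>R b | c :: 'a \<Rightarrow> int. True}"

definition is_lattice :: "'a::euclidean_space set \<Rightarrow> ('a \<Rightarrow> 'a \<Rightarrow> real) \<Rightarrow> bool" where
  "is_lattice L B \<longleftrightarrow>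
     (\<exists>S. finite S \<and> independent S \<and> span S = UNIV \<and> L = integer_span S) \<and>
     bilinear B \<and> (\<forall>x y. B x y = B y x) \<and> (\<forall>x\<in>L. \<forall>y\<in>L. B x y \<in> \<int>)"

definition even_lattice :: "'a::euclidean_space set \<Rightarrow> ('a \<Rightarrow> 'a \<Rightarrow> real) \<Rightarrow> bool" where
  "even_lattice L B \<longleftrightarrow> is_lattice L B \<and> (\<forall>x\<in>L. \<exists>k::int. B x x = of_int (2 * k))"

text \<open>
  An orthogonal basis with \<open>p\<close> vectors of positive and \<open>q\<close> vectors of negative square; in
  particular the form is nondegenerate.
\<close>

definition has_signature :: "('a::euclidean_space \<Rightarrow> 'a \<Rightarrow> real) \<Rightarrow> nat \<Rightarrow> nat \<Rightarrow> bool" where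
  "has_signature B p q \<longleftrightarrow>
     (\<exists>S T. finite S \<and> finite T \<and> S \<inter> T = {} \<and> card S = p \<and> card T = q \<and>
        independent (S \<union> T) \<and> span (S \<union> T) = UNIV \<and>
        pairwise (\<lambda>x y. B x y = 0) (S \<union> T) \<and>
        (\<forall>x\<in>S. B x x > 0) \<and> (\<forall>x\<in>T. B x x < 0))"

definition even_hyperbolic_lattice :: "'a::euclidean_space set \<Rightarrow> ('a \<Rightarrow> 'a \<Rightarrow> real) \<Rightarrow> bool" where
  "even_hyperbolic_lattice L B \<longleftrightarrow> even_lattice L B \<and> (\<exists>n\<ge>1. has_signature B 1 n)"

definition roots :: "'a set \<Rightarrow> ('a \<Rightarrow> 'a \<Rightarrow> real) \<Rightarrow> 'a set" where
  "roots L B = {r \<in> L. B r r = -2}"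

definition root_hyperplane :: "('a \<Rightarrow> 'a \<Rightarrow> real) \<Rightarrow> 'a \<Rightarrow> 'a set" where
  "root_hyperplane B r = {x. B x r = 0}"

definition positive_cone :: "('a::euclidean_space \<Rightarrow> 'a \<Rightarrow> real) \<Rightarrow> 'a set \<Rightarrow> bool" where
  "positive_cone B P \<longleftrightarrow> P \<in> components {x. B x x > 0}"

text \<open>Isometries of \<open>L\<close> are identified with their linear extensions to \<open>L \<otimes> \<real>\<close>.\<close>

definition isometries :: "'a::euclidean_space set \<Rightarrow> ('a \<Rightarrow> 'a \<Rightarrow> real) \<Rightarrow> ('a \<Rightarrow> 'a) set" where
  "isometries L B = {f. linear f \<and> f ` L = L \<and> (\<forall>x\<in>L. \<forall>y\<in>L. B (f x) (f y) = B x y)}"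

definition isometries_plus ::
    "'a::euclidean_space set \<Rightarrow> ('a \<Rightarrow> 'a \<Rightarrow> real) \<Rightarrow> 'a set \<Rightarrow> ('a \<Rightarrow> 'a) set" where
  "isometries_plus L B P = {f \<in> isometries L B. f ` P = P}"

definition chambers ::
    "'a::euclidean_space set \<Rightarrow> ('a \<Rightarrow> 'a \<Rightarrow> real) \<Rightarrow> 'a set \<Rightarrow> 'a set set" where
  "chambers L B P = components (P - (\<Union>r\<in>roots L B. root_hyperplane B r))"

definition positive_isometry ::
    "'a::euclidean_space set \<Rightarrow> ('a \<Rightarrow> 'a \<Rightarrow> real) \<Rightarrow> 'a set \<Rightarrow> ('a \<Rightarrow> 'a) \<Rightarrow> bool" where
  "positive_isometry L B P f \<longleftrightarrow>
     f \<in> isometries_plus L B P \<and> (\<exists>M\<in>chambers L B P. f ` M = M)"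

text \<open>
  The spectrum is that of the complexification of \<open>f\<close>: writing \<open>z = a + \<i> b\<close>, the two equations
  are the real and imaginary parts of \<open>f (x + \<i> y) = z (x + \<i> y)\<close>.
\<close>

definition complex_spectrum :: "('a::real_vector \<Rightarrow> 'a) \<Rightarrow> complex set" where
  "complex_spectrum f =
     {z. \<exists>x y. (x \<noteq> 0 \<or> y \<noteq> 0) \<and>
           f x = Re z *\<^sub>R x - Im z *\<^sub>R y \<and> f y = Im z *\<^sub>R x + Re z *\<^sub>R y}"

definition spectral_radius :: "('a::real_vector \<Rightarrow> 'a) \<Rightarrow> real" where
  "spectral_radius f = Max (cmod ` complex_spectrum f)"

definition cyclic_roots ::
    "'a::real_vector set \<Rightarrow> ('a \<Rightarrow> 'a \<Rightarrow> real) \<Rightarrow> ('a \<Rightarrow> 'a) \<Rightarrow> 'a set" where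
  "cyclic_roots L B f = {r \<in> L. B r r = -2 \<and> (\<exists>i\<ge>1. (\<Sum>k=0..i. (f ^^ k) r) = 0)}"

definition orthogonal_roots :: "'a set \<Rightarrow> ('a \<Rightarrow> 'a \<Rightarrow> real) \<Rightarrow> 'a \<Rightarrow> 'a set" where
  "orthogonal_roots L B h = {r \<in> L. B r r = -2 \<and> B r h = 0}"

definition separating_roots ::
    "'a set \<Rightarrow> ('a \<Rightarrow> 'a \<Rightarrow> real) \<Rightarrow> ('a \<Rightarrow> 'a) \<Rightarrow> 'a \<Rightarrow> 'a set" where
  "separating_roots L B f h = {r \<in> L. B r r = -2 \<and> B r h * B r (f h) < 0}"

end

theory Submission
  imports Defs
begin

text \<open>
  The roots whose hyperplane meets a given compact set of vectors of positive square are finite in number;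
  the compact sets \<open>{v + w}\<close>, \<open>{h}\<close> and the segment from \<open>h\<close> to \<open>f h\<close> give the three
  finiteness claims. If \<open>f\<close> fixes a chamber, a root has constant sign along every orbit in it;
  as \<open>k \<rightarrow> \<plusminus>\<infinity>\<close> the orbit \<open>f\<^sup>k x\<close> tends in direction to \<open>v\<close> and to \<open>w\<close>, so
  \<open>B r v\<close> and \<open>B r w\<close> cannot have opposite signs. Conversely, a root with \<open>B r v * B r w < 0\<close>
  changes sign somewhere along the orbit of \<open>h\<close>, hence has a translate in \<open>R\<^sub>h \<union> S\<^sub>h\<close>. If there
  are no such roots, only finitely many roots vanish on the axis spanned by \<open>v\<close> and \<open>w\<close>, and
  a small perturbation of \<open>v + w\<close> by a vector on which these roots take \<open>f\<close>-invariant nonzero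
  values lies in an invariant chamber.
\<close>

section \<open>Lattice points in bounded sets, linear functionals and periods\<close>

text \<open>The coordinate functionals of a basis are bounded on \<open>X\<close>, so the integer
  coordinates of lattice points in \<open>X\<close> range over a finite box.\<close>

lemma finite_integer_span_Int_bounded:
  fixes S :: "'a::euclidean_space set"
  assumes "finite S" "independent S" "bounded X"
  shows "finite (integer_span S \<inter> X)"
proof -
  obtain C where C: "norm x \<le> C" if "x \<in> X" for x
    using \<open>bounded X\<close> bounded_iff by blast
  have "\<exists>M. \<forall>c::'a \<Rightarrow> int. (\<Sum>b\<in>S. of_int (c b) *\<^sub>R b) \<in> X \<longrightarrow> \<bar>real_of_int (c a)\<bar> \<le> M"
    if "a \<in> S" for a
  proof -
    obtain \<phi> :: "'a \<Rightarrow> real" where \<phi>: "linear \<phi>" "\<And>b. b \<in> S \<Longrightarrow> \<phi> b = (if b = a then 1 else 0)"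
      using linear_independent_extend[OF assms(2), of "\<lambda>b. if b = a then 1 else 0"] by blast
    obtain K where K: "\<And>x. \<bar>\<phi> x\<bar> \<le> norm x * K" "K > 0"
      using \<phi>(1) by (metis bounded_linear.pos_bounded linear_conv_bounded_linear real_norm_def)
    have "\<bar>real_of_int (c a)\<bar> \<le> C * K" if "(\<Sum>b\<in>S. of_int (c b) *\<^sub>R b) \<in> X" for c :: "'a \<Rightarrow> int"
    proof -
      have "\<phi> (\<Sum>b\<in>S. of_int (c b) *\<^sub>R b) = (\<Sum>b\<in>S. of_int (c b) * \<phi> b)"
        using \<phi>(1) by (simp add: linear_sum linear_cmul)
      also have "\<dots> = (\<Sum>b\<in>S. if b = a then of_int (c b) else 0)"
        by (rule sum.cong) (auto simp: \<phi>(2))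
      also have "\<dots> = of_int (c a)"
        using \<open>a \<in> S\<close> assms(1) by simp
      finally have "\<bar>real_of_int (c a)\<bar> \<le> norm (\<Sum>b\<in>S. of_int (c b) *\<^sub>R b) * K"
        using K(1) by metis
      also have "\<dots> \<le> C * K"
        using C[OF that] K(2) by (simp add: mult_right_mono)
      finally show ?thesis .
    qed
    then show ?thesis by blast
  qed
  then obtain M where M: "\<And>a (c::'a \<Rightarrow> int).
      a \<in> S \<Longrightarrow> (\<Sum>b\<in>S. of_int (c b) *\<^sub>R b) \<in> X \<Longrightarrow> \<bar>real_of_int (c a)\<bar> \<le> M a"
    by metis
  let ?I = "\<lambda>a. {- \<lfloor>M a\<rfloor>..\<lfloor>M a\<rfloor>}"
  have "integer_span S \<inter> X \<subseteq> (\<lambda>c. \<Sum>b\<in>S. of_int (c b) *\<^sub>R b) ` (PiE S ?I)"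
  proof
    fix x assume "x \<in> integer_span S \<inter> X"
    then obtain c :: "'a \<Rightarrow> int" where x: "x = (\<Sum>b\<in>S. of_int (c b) *\<^sub>R b)" "x \<in> X"
      unfolding integer_span_def by auto
    have "c a \<in> ?I a" if "a \<in> S" for a
    proof -
      have "\<bar>real_of_int (c a)\<bar> \<le> M a" using M that x by blast
      then show ?thesis by (simp add: abs_le_iff) linarith
    qed
    then have "restrict c S \<in> PiE S ?I" by auto
    moreover have "x = (\<Sum>b\<in>S. of_int (restrict c S b) *\<^sub>R b)" by (simp add: x(1))
    ultimately show "x \<in> (\<lambda>c. \<Sum>b\<in>S. of_int (c b) *\<^sub>R b) ` (PiE S ?I)" by blast
  qed
  then show ?thesis
    by (rule finite_subset) (simp add: finite_PiE assms(1))
qed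

lemma subset_integer_span:
  assumes "finite S"
  shows "S \<subseteq> integer_span S"
proof
  fix a assume "a \<in> S"
  have "(\<Sum>b\<in>S. of_int (if b = a then 1 else 0) *\<^sub>R b) = (\<Sum>b\<in>S. if b = a then b else 0)"
    by (rule sum.cong) auto
  also have "\<dots> = a" using \<open>a \<in> S\<close> assms by simp
  finally show "a \<in> integer_span S"
    unfolding integer_span_def by (auto intro!: exI[of _ "\<lambda>b. if b = a then 1 else 0"])
qed

lemma connected_nonvanishing_same_sign:
  fixes \<phi> :: "'a::euclidean_space \<Rightarrow> real"
  assumes "linear \<phi>" "connected X" "\<And>x. x \<in> X \<Longrightarrow> \<phi> x \<noteq> 0" "x \<in> X" "y \<in> X"
  shows "\<phi> x * \<phi> y > 0"
proof (rule ccontr)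
  assume "\<not> \<phi> x * \<phi> y > 0"
  then have *: "\<phi> x < 0 \<and> 0 < \<phi> y \<or> \<phi> y < 0 \<and> 0 < \<phi> x"
    using assms(3)[OF assms(4)] assms(3)[OF assms(5)]
    by (metis linorder_neqE_linordered_idom mult_neg_neg mult_pos_pos)
  have "connected (\<phi> ` X)"
    using assms(1,2) by (intro connected_continuous_image linear_continuous_on)
      (simp add: linear_conv_bounded_linear)
  then have "0 \<in> \<phi> ` X"
    using * assms(4,5) unfolding connected_iff_interval by (meson image_eqI less_imp_le)
  then show False using assms(3) by auto
qed

text \<open>Kernels of nonzero functionals are proper subspaces, hence Lebesgue null sets, and
  finitely many null sets cannot cover the space.\<close>

lemma avoid_finitely_many_hyperplanes:
  fixes \<phi> :: "'b \<Rightarrow> 'a::euclidean_space \<Rightarrow> real"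
  assumes "finite F" "\<And>i. i \<in> F \<Longrightarrow> linear (\<phi> i)" "\<And>i. i \<in> F \<Longrightarrow> \<exists>x. \<phi> i x \<noteq> 0"
  shows "\<exists>z. \<forall>i\<in>F. \<phi> i z \<noteq> 0"
proof -
  have "negligible {x. \<phi> i x = 0}" if "i \<in> F" for i
  proof (rule negligible_lowdim)
    have sub: "subspace {x. \<phi> i x = 0}"
      using linear_subspace_kernel assms(2)[OF that] by blast
    have "{x. \<phi> i x = 0} \<noteq> UNIV" using assms(3)[OF that] by auto
    then show "dim {x. \<phi> i x = 0} < DIM('a)"
      by (metis sub dim_eq_full dim_subset_UNIV le_neq_implies_less span_eq_iff)
  qed
  then have "negligible (\<Union>i\<in>F. {x. \<phi> i x = 0})"
    by (intro negligible_Union finite_imageI assms(1)) auto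
  then have "(\<Union>i\<in>F. {x. \<phi> i x = 0}) \<noteq> UNIV"
    using non_negligible_UNIV by metis
  then show ?thesis by auto
qed

text \<open>Injectivity makes every point with a finite orbit periodic, not only eventually
  periodic. The product of the individual periods then serves all points of
  \<open>F\<close>.\<close>

lemma common_period:
  assumes "inj p" "finite F" "p ` F \<subseteq> F"
  obtains m where "m > 0" "\<And>x. x \<in> F \<Longrightarrow> (p ^^ m) x = x"
proof -
  have "\<exists>n>0. (p ^^ n) x = x" if "x \<in> F" for x
  proof -
    have "(p ^^ n) x \<in> F" for n using assms(3) that by (induction n) auto
    then have "finite {y. \<exists>n. y = (p ^^ n) x}"
      by (intro finite_subset[OF _ assms(2)]) auto
    with assms(1) show ?thesis by (metis funpow_inj_finite)
  qed
  then obtain n where n: "\<And>x. x \<in> F \<Longrightarrow> n x > 0 \<and> (p ^^ n x) x = x" by metis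
  show ?thesis
  proof
    show "prod n F > 0" using n by (simp add: prod_pos)
    show "(p ^^ prod n F) x = x" if "x \<in> F" for x
    proof -
      have "prod n F = n x * prod n (F - {x})"
        using that assms(2) by (simp add: prod.remove)
      moreover have "((p ^^ n x) ^^ k) x = x" for k
        using n[OF that] by (induction k) auto
      ultimately show ?thesis by (simp add: funpow_mult)
    qed
  qed
qed

section \<open>Forms of signature (1,n) and their positive cones\<close>

text \<open>The signature enters through one basis-free consequence: the orthogonal complement of
  any vector of positive square is negative definite. \<open>hyperbolic_formI\<close> derives
  it.\<close>

locale hyperbolic_form =
  fixes B :: "'a::euclidean_space \<Rightarrow> 'a \<Rightarrow> real"
  assumes bilinear: "bilinear B"
    and sym: "B x y = B y x"
    and perp_negative: "B u u > 0 \<Longrightarrow> B x u = 0 \<Longrightarrow> x \<noteq> 0 \<Longrightarrow> B x x < 0"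
begin

lemmas B_simps = bilinear_ladd[OF bilinear] bilinear_radd[OF bilinear]
  bilinear_lsub[OF bilinear] bilinear_rsub[OF bilinear]
  bilinear_lmul[OF bilinear] bilinear_rmul[OF bilinear]
  bilinear_lneg[OF bilinear] bilinear_rneg[OF bilinear]
  bilinear_lzero[OF bilinear] bilinear_rzero[OF bilinear]

lemma linear_left: "linear (\<lambda>x. B x y)"
  using bilinear by (simp add: bilinear_def)

lemma linear_right: "linear (\<lambda>y. B x y)"
  using bilinear by (simp add: bilinear_def)

lemma continuous_on_form [continuous_intros]:
  "continuous_on S a \<Longrightarrow> continuous_on S b \<Longrightarrow> continuous_on S (\<lambda>x. B (a x) (b x))"
  using bounded_bilinear.continuous_on bilinear bilinear_conv_bounded_bilinear by blast

lemma perp_nonpositive: "B u u > 0 \<Longrightarrow> B x u = 0 \<Longrightarrow> B x x \<le> 0"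
  using perp_negative[of u x] by (cases "x = 0") (auto simp: B_simps)

text \<open>Split \<open>y = a x + n\<close> with \<open>n\<close> orthogonal to \<open>x\<close>.
  The expression equals \<open>B y y\<close> with the sign of the negative definite part reversed,
  namely \<open>a^2 * B x x - B n n\<close>.\<close>

lemma majorant_pos:
  assumes "B x x > 0" "y \<noteq> 0"
  shows "2 * (B x y)\<^sup>2 / B x x - B y y > 0"
proof -
  define a where "a = B x y / B x x"
  define n where "n = y - a *\<^sub>R x"
  have y: "y = a *\<^sub>R x + n" by (simp add: n_def)
  have n: "B n x = 0" using assms by (simp add: n_def B_simps a_def sym[of y x])
  have "B x y = a * B x x" using assms by (simp add: a_def)
  then have "2 * (B x y)\<^sup>2 / B x x = 2 * a\<^sup>2 * B x x"
    using assms by (simp add: power2_eq_square)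
  moreover have "B y y = a\<^sup>2 * B x x + B n n"
    using n by (simp add: y B_simps sym[of x n] power2_eq_square)
  ultimately have eq: "2 * (B x y)\<^sup>2 / B x x - B y y = a\<^sup>2 * B x x - B n n" by simp
  show ?thesis
  proof (cases "n = 0")
    case True
    then have "a \<noteq> 0" using assms y by auto
    then show ?thesis using eq assms True by (simp add: B_simps)
  next
    case False
    have "a\<^sup>2 * B x x \<ge> 0" using assms by simp
    then show ?thesis using perp_negative[OF assms(1) n False] eq by linarith
  qed
qed

text \<open>On vectors \<open>y\<close> orthogonal to \<open>x\<close> the positive definite form of \<open>majorant_pos\<close> takes the
  value \<open>- B y y\<close>, and by compactness these forms are bounded below uniformly in \<open>x \<in> K\<close>.\<close>

lemma bounded_perp_to_compact:
  assumes "compact K" "\<And>x. x \<in> K \<Longrightarrow> B x x > 0"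
  shows "bounded {y. \<exists>x\<in>K. B x y = 0 \<and> B y y \<ge> c}"
proof (cases "K = {}")
  case False
  define Q where "Q x y = 2 * (B x y)\<^sup>2 / B x x - B y y" for x y
  let ?D = "K \<times> sphere (0::'a) 1"
  have "compact ?D" by (intro compact_Times assms(1)) simp
  moreover have "?D \<noteq> {}" using False by simp
  moreover have "continuous_on ?D (\<lambda>p. Q (fst p) (snd p))"
  proof -
    have "\<forall>p\<in>?D. B (fst p) (fst p) \<noteq> 0" using assms(2) by force
    then show ?thesis unfolding Q_def by (intro continuous_intros) auto
  qed
  ultimately obtain p where p: "p \<in> ?D"
      "\<forall>q\<in>?D. Q (fst p) (snd p) \<le> Q (fst q) (snd q)"
    using continuous_attains_inf[of ?D "\<lambda>p. Q (fst p) (snd p)"] by blast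
  define m where "m = Q (fst p) (snd p)"
  have "fst p \<in> K" "snd p \<noteq> 0" using p(1) by auto
  then have m: "m > 0"
    using majorant_pos[of "fst p" "snd p"] assms(2) by (simp add: m_def Q_def)
  \<comment> \<open>The summand 1 takes care of short \<open>y\<close>. If
    \<open>norm y > 1\<close>, then \<open>norm y\<close> is at most its square, which rescaling to
    the unit sphere bounds by \<open>\<bar>c\<bar> / m\<close>.\<close>
  have "norm y \<le> \<bar>c\<bar> / m + 1" if xy: "x \<in> K" "B x y = 0" "B y y \<ge> c" for x y
  proof (cases "norm y \<le> 1")
    case True
    then show ?thesis using m by (simp add: add_increasing)
  next
    case False
    define z where "z = (1 / norm y) *\<^sub>R y"
    have "norm y > 0" using False by linarith
    then have y: "y = norm y *\<^sub>R z" and z: "norm z = 1" by (auto simp: z_def)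
    have "(x, z) \<in> ?D" using xy z by auto
    then have "m \<le> Q x z" using p(2) by (force simp: m_def)
    also have "\<dots> = - B z z" using xy(2) by (simp add: Q_def z_def B_simps)
    finally have "m * (norm y)\<^sup>2 \<le> - B z z * (norm y)\<^sup>2" by (rule mult_right_mono) simp
    also have "\<dots> = - B y y"
      using arg_cong2[OF y y, of B] by (simp add: B_simps power2_eq_square)
    finally have "(norm y)\<^sup>2 \<le> \<bar>c\<bar> / m"
      using m xy by (simp add: pos_le_divide_eq mult.commute)
    moreover have "norm y \<le> (norm y)\<^sup>2"
      using False self_le_power[of "norm y" 2] by simp
    ultimately show ?thesis by linarith
  qed
  then show ?thesis unfolding bounded_iff by blast
qed simp

text \<open>For \<open>u\<close> of positive square this is an explicit form of the component of the
  positive vectors that contains \<open>u\<close>; see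
  \<open>positive_cone_eq_half_cone\<close>.\<close>

definition half_cone :: "'a \<Rightarrow> 'a set" where
  "half_cone u = {x. B x x > 0 \<and> B x u > 0}"

text \<open>The combination \<open>z\<close> of \<open>x\<close> and \<open>y\<close> that is
  orthogonal to \<open>u\<close> has square at most 0. If \<open>B x y\<close> were not positive,
  expanding that square would give a positive number.\<close>

lemma half_cone_mult_pos:
  assumes "B u u > 0" "x \<in> half_cone u" "y \<in> half_cone u"
  shows "B x y > 0"
proof (rule ccontr)
  assume "\<not> B x y > 0"
  then have le: "B x y \<le> 0" by simp
  have x: "B x x > 0" "B x u > 0" and y: "B y y > 0" "B y u > 0"
    using assms by (auto simp: half_cone_def)
  define z where "z = B y u *\<^sub>R x - B x u *\<^sub>R y"
  have "B z u = 0" by (simp add: z_def B_simps)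
  then have "B z z \<le> 0" using perp_nonpositive assms(1) by blast
  moreover have "B z z = (B y u)\<^sup>2 * B x x - 2 * (B x u * B y u) * B x y + (B x u)\<^sup>2 * B y y"
    by (simp add: z_def B_simps sym[of y x] algebra_simps power2_eq_square)
  moreover have "(B y u)\<^sup>2 * B x x > 0" "(B x u)\<^sup>2 * B y y > 0" using x y by auto
  moreover have "2 * (B x u * B y u) * B x y \<le> 0"
    using le x y by (simp add: mult_nonneg_nonpos)
  ultimately show False by linarith
qed

lemma convex_half_cone:
  assumes "B u u > 0"
  shows "convex (half_cone u)"
proof (rule convexI)
  fix x y and a b :: real
  assume *: "x \<in> half_cone u" "y \<in> half_cone u" "0 \<le> a" "0 \<le> b" "a + b = 1"
  have x: "B x x > 0" "B x u > 0" and y: "B y y > 0" "B y u > 0"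
    using * by (auto simp: half_cone_def)
  have xy: "B x y > 0" using half_cone_mult_pos assms * by blast
  have "B (a *\<^sub>R x + b *\<^sub>R y) (a *\<^sub>R x + b *\<^sub>R y) = a * a * B x x + 2 * (a * b * B x y) + b * b * B y y"
    by (simp add: B_simps sym[of y x] algebra_simps)
  moreover have "a > 0 \<or> b > 0" using * by auto
  then have "a * a * B x x > 0 \<or> b * b * B y y > 0" "a * B x u > 0 \<or> b * B y u > 0"
    using x y by auto
  moreover have "a * a * B x x \<ge> 0" "b * b * B y y \<ge> 0" "a * b * B x y \<ge> 0"
      "a * B x u \<ge> 0" "b * B y u \<ge> 0"
    using x y xy * by auto
  ultimately show "a *\<^sub>R x + b *\<^sub>R y \<in> half_cone u"
    by (auto simp: half_cone_def B_simps)
qed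

text \<open>The half cone is convex, hence connected, and so lies in the component of
  \<open>u\<close>. Conversely \<open>B x u\<close> cannot vanish for \<open>x\<close> of positive
  square, so it keeps its sign on the connected set \<open>P\<close>.\<close>

lemma positive_cone_eq_half_cone:
  assumes P: "positive_cone B P" and u: "u \<in> P"
  shows "P = half_cone u"
proof
  have comp: "P \<in> components {x. B x x > 0}" using P by (simp add: positive_cone_def)
  have pos: "B x x > 0" if "x \<in> P" for x using in_components_subset[OF comp] that by auto
  have uu: "B u u > 0" using pos u by blast
  show "half_cone u \<subseteq> P"
  proof (rule components_maximal[OF comp])
    show "connected (half_cone u)" using convex_half_cone[OF uu] by (rule convex_connected)
    show "half_cone u \<subseteq> {x. B x x > 0}" by (auto simp: half_cone_def)
    show "P \<inter> half_cone u \<noteq> {}" using u uu by (auto simp: half_cone_def)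
  qed
  show "P \<subseteq> half_cone u"
  proof
    fix x assume x: "x \<in> P"
    have "B x u * B u u > 0"
    proof (rule connected_nonvanishing_same_sign[OF linear_left])
      show "connected P" using comp in_components_connected by blast
      show "B y u \<noteq> 0" if "y \<in> P" for y
        using perp_nonpositive[OF uu, of y] pos[OF that] by linarith
    qed (use x u in auto)
    then show "x \<in> half_cone u" using uu pos[OF x] by (simp add: half_cone_def zero_less_mult_iff)
  qed
qed

lemma positive_cone_cases:
  assumes P: "positive_cone B P" and x: "B x x > 0"
  shows "x \<in> P \<or> - x \<in> P"
proof -
  obtain u where u: "u \<in> P" 
    using P in_components_nonempty unfolding positive_cone_def by blast
  then have "B u u > 0" using P in_components_subset unfolding positive_cone_def by blast
  then have "B x u \<noteq> 0" using perp_nonpositive[of u x] x by fastforce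
  then show ?thesis
    using positive_cone_eq_half_cone[OF P u] x by (auto simp: half_cone_def B_simps)
qed

lemma convex_positive_cone:
  assumes P: "positive_cone B P"
  shows "convex P"
proof -
  obtain u where u: "u \<in> P" 
    using P in_components_nonempty unfolding positive_cone_def by blast
  then have "B u u > 0" using P in_components_subset unfolding positive_cone_def by blast
  then show ?thesis using convex_half_cone positive_cone_eq_half_cone[OF P u] by simp
qed

end

section \<open>The complement property from an orthogonal basis\<close>

text \<open>Splitting off one vector of \<open>T\<close> at a time shows that \<open>span T\<close>
  is negative definite. It contains the complement of the positive basis vector \<open>e\<close>,
  and the property is then carried over from \<open>e\<close> to an arbitrary \<open>u\<close> of
  positive square.\<close>

lemma hyperbolic_formI:
  fixes B :: "'a::euclidean_space \<Rightarrow> 'a \<Rightarrow> real"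
  assumes bil: "bilinear B" and sym: "\<And>x y. B x y = B y x" and sig: "has_signature B 1 n"
  shows "hyperbolic_form B"
proof
  note B_simps = bilinear_ladd[OF bil] bilinear_radd[OF bil]
    bilinear_lsub[OF bil] bilinear_rsub[OF bil]
    bilinear_lmul[OF bil] bilinear_rmul[OF bil] bilinear_lzero[OF bil] bilinear_rzero[OF bil]
  obtain S T where ST: "finite T" "S \<inter> T = {}" "card S = 1" "span (S \<union> T) = UNIV"
      "pairwise (\<lambda>x y. B x y = 0) (S \<union> T)" "\<forall>x\<in>S. B x x > 0" "\<forall>x\<in>T. B x x < 0"
    using sig unfolding has_signature_def by blast
  obtain e where S: "S = {e}" using ST(3) card_1_singletonE by blast
  have ee: "B e e > 0" using ST S by simp
  have orth: "B y x = 0" if "\<And>t. t \<in> U \<Longrightarrow> B t x = 0" "y \<in> span U" for x y U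
    using that(2) by (induction rule: span_induct_alt) (auto simp: B_simps that(1))
  have neg: "y = 0 \<or> B y y < 0" if "y \<in> span T" for y
    using ST(1) subset_refl[of T] that
  proof (induction T arbitrary: y rule: finite_subset_induct')
    case (insert t U)
    obtain k where k: "y - k *\<^sub>R t \<in> span U" using insert.prems by (auto simp: span_insert)
    define z where "z = y - k *\<^sub>R t"
    have y: "y = k *\<^sub>R t + z" by (simp add: z_def)
    have "B s t = 0" if "s \<in> U" for s
      using ST(5) insert that unfolding pairwise_def by (metis UnI2 subsetD)
    then have "B z t = 0" using orth k z_def by blast
    then have "B y y = k * k * B t t + B z z"
      using sym[of t z] by (simp add: y B_simps)
    moreover have "B t t < 0" using ST(7) insert by blast
    moreover have "z = 0 \<or> B z z < 0" using insert k z_def by blast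
    moreover have "k * k > 0" if "k \<noteq> 0" using that by (auto simp: zero_less_mult_iff)
    ultimately have "B y y < 0" if "k \<noteq> 0"
      using that mult_pos_neg[of "k * k" "B t t"] by (cases "z = 0") (auto simp: B_simps)
    then show ?case using y \<open>z = 0 \<or> B z z < 0\<close> by (cases "k = 0") auto
  qed auto
  have neg_e: "x = 0 \<or> B x x < 0" if "B x e = 0" for x
  proof -
    have "x \<in> span (insert e T)" using ST(4) S by simp
    then obtain k where k: "x - k *\<^sub>R e \<in> span T" by (auto simp: span_insert)
    have "B t e = 0" if "t \<in> T" for t
      using ST(2,5) that S unfolding pairwise_def by (metis UnCI disjoint_iff singletonI)
    then have "B (x - k *\<^sub>R e) e = 0" using orth k by blast
    then have "k = 0" using that ee by (simp add: B_simps)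
    then show ?thesis using k neg by simp
  qed
  show "B x x < 0" if u: "B u u > 0" and xu: "B x u = 0" and x: "x \<noteq> 0" for u x
  proof (rule ccontr)
    assume "\<not> B x x < 0"
    then have xx: "B x x \<ge> 0" by simp
    \<comment> \<open>This combination of the orthogonal vectors \<open>x\<close> and
      \<open>u\<close> lies in the complement of \<open>e\<close>, yet its square is nonnegative, so
      it vanishes. Pairing it with \<open>u\<close> puts \<open>x\<close> itself into the complement
      of \<open>e\<close>.\<close>
    define z where "z = B u e *\<^sub>R x - B x e *\<^sub>R u"
    have "B z e = 0" by (simp add: z_def B_simps)
    moreover have "B z z = (B u e)\<^sup>2 * B x x + (B x e)\<^sup>2 * B u u"
      using xu by (simp add: z_def B_simps sym[of u x] power2_eq_square algebra_simps)
    then have "B z z \<ge> 0" using xx u by simp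
    ultimately have "z = 0" using neg_e[of z] by linarith
    then have "B z u = 0" by (simp add: B_simps)
    then have "B x e = 0" using xu u by (simp add: z_def B_simps)
    then show False using neg_e[of x] x xx by simp
  qed
qed (use bil sym in auto)

section \<open>Dynamics of an isometry with eigenvalues \<tau> and 1/\<tau>\<close>

text \<open>The inverse \<open>g\<close> is a parameter, so that negative powers of \<open>f\<close>
  are natural powers of \<open>g\<close>.\<close>

locale hyperbolic_isometry = hyperbolic_form B
  for B :: "'a::euclidean_space \<Rightarrow> 'a \<Rightarrow> real" +
  fixes f g :: "'a \<Rightarrow> 'a" and \<tau> :: real and v w :: 'a
  assumes linear_f: "linear f" and linear_g: "linear g"
    and f_g [simp]: "f (g x) = x" and g_f [simp]: "g (f x) = x"
    and f_isometry: "B (f x) (f y) = B x y"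
    and tau: "\<tau> > 1"
    and f_v: "f v = \<tau> *\<^sub>R v" and f_w: "f w = inverse \<tau> *\<^sub>R w"
    and v_w: "B v w > 0"
begin

text \<open>Time reversal: every result for \<open>f\<close> and \<open>v\<close> yields one for
  \<open>g\<close> and \<open>w\<close>, so each limit has to be computed in one direction
  only.\<close>

lemma inverse_isometry: "hyperbolic_isometry B g f \<tau> w v"
proof (intro hyperbolic_isometry.intro hyperbolic_isometry_axioms.intro hyperbolic_form_axioms)
  have "w = inverse \<tau> *\<^sub>R g w" using g_f[of w] linear_g by (simp add: f_w linear_cmul)
  then have "\<tau> *\<^sub>R w = \<tau> *\<^sub>R (inverse \<tau> *\<^sub>R g w)" by simp
  then show "g w = \<tau> *\<^sub>R w" using tau by simp
  have "v = \<tau> *\<^sub>R g v" using g_f[of v] linear_g by (simp add: f_v linear_cmul)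
  then have "inverse \<tau> *\<^sub>R v = inverse \<tau> *\<^sub>R (\<tau> *\<^sub>R g v)" by simp
  then show "g v = inverse \<tau> *\<^sub>R v" using tau by simp
  show "B (g x) (g y) = B x y" for x y using f_isometry[of "g x" "g y"] by simp
  show "B w v > 0" using v_w sym by metis
qed (use linear_f linear_g tau in auto)

lemma g_v: "g v = inverse \<tau> *\<^sub>R v" and g_w: "g w = \<tau> *\<^sub>R w"
  using hyperbolic_isometry.f_v[OF inverse_isometry] hyperbolic_isometry.f_w[OF inverse_isometry]
  by auto

lemma v_isotropic: "B v v = 0"
proof -
  have "\<tau> * \<tau> * B v v = B v v" using f_isometry[of v v] by (simp add: f_v B_simps)
  moreover have "\<tau> * \<tau> > 1" using tau by (simp add: less_1_mult)
  ultimately show ?thesis by auto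
qed

lemma w_isotropic: "B w w = 0"
  using hyperbolic_isometry.v_isotropic[OF inverse_isometry] .

lemma square_v_plus_w: "B (v + w) (v + w) > 0"
  using v_w by (simp add: B_simps v_isotropic w_isotropic sym[of w v])

lemma f_adjoint: "B (f x) y = B x (g y)"
  using f_isometry[of x "g y"] by simp

lemma funpow_adjoint: "B ((f ^^ k) x) y = B x ((g ^^ k) y)"
  by (induction k arbitrary: y) (simp_all add: f_adjoint funpow_swap1[of g])

lemma f_image_v: "B (f x) v = inverse \<tau> * B x v" and f_image_w: "B (f x) w = \<tau> * B x w"
  by (simp_all add: f_adjoint g_v g_w B_simps)

lemma funpow_image_v: "B ((f ^^ k) x) v = inverse \<tau> ^ k * B x v"
  by (induction k) (simp_all add: f_image_v)

lemma linear_funpow: "linear (f ^^ k)"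
proof (induction k)
  case (Suc k)
  then show ?case using linear_compose[OF Suc linear_f] by (simp add: o_def)
qed (simp add: linear_id[unfolded id_def])

lemma funpow_isometry: "B ((f ^^ k) x) ((f ^^ k) y) = B x y"
  by (induction k) (simp_all add: f_isometry)

lemma funpow_v: "(f ^^ k) v = \<tau> ^ k *\<^sub>R v"
  by (induction k) (simp_all add: f_v linear_cmul[OF linear_f])

lemma funpow_w: "(f ^^ k) w = inverse \<tau> ^ k *\<^sub>R w"
  by (induction k) (simp_all add: f_w linear_cmul[OF linear_f])

lemma isotropic_decomposition:
  obtains n where "x = (B x w / B v w) *\<^sub>R v + (B x v / B v w) *\<^sub>R w + n" "B n v = 0" "B n w = 0"
proof
  let ?n = "x - (B x w / B v w) *\<^sub>R v - (B x v / B v w) *\<^sub>R w"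
  show "x = (B x w / B v w) *\<^sub>R v + (B x v / B v w) *\<^sub>R w + ?n" by simp
  show "B ?n v = 0" "B ?n w = 0"
    using v_w by (simp_all add: B_simps v_isotropic w_isotropic sym[of w v])
qed

text \<open>For \<open>x = a v + b w + n\<close> with \<open>n\<close> orthogonal to
  \<open>v\<close> and \<open>w\<close>, the square of \<open>x\<close> is
  \<open>2 * a * b * B v w + B n n\<close>. As \<open>n\<close> is orthogonal to
  \<open>v + w\<close>, its square is at most 0, which forces \<open>a * b > 0\<close>.\<close>

lemma mult_v_w_pos:
  assumes "B x x > 0"
  shows "B x v * B x w > 0"
proof -
  obtain n where x: "x = (B x w / B v w) *\<^sub>R v + (B x v / B v w) *\<^sub>R w + n"
      and n: "B n v = 0" "B n w = 0"
    using isotropic_decomposition by blast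
  define a b where "a = B x w / B v w" and "b = B x v / B v w"
  have x: "x = a *\<^sub>R v + b *\<^sub>R w + n" using x by (simp add: a_def b_def)
  have "B n n \<le> 0" using perp_nonpositive[OF square_v_plus_w] n by (simp add: B_simps)
  moreover have "B x x = 2 * (a * b * B v w) + B n n"
    using arg_cong2[OF x x, of B] n
    by (simp add: B_simps v_isotropic w_isotropic sym[of w v] sym[of v n] sym[of w n])
  ultimately have "a * b * B v w > 0" using assms by linarith
  then have "a * b > 0" using v_w by (simp add: zero_less_mult_iff)
  then show ?thesis using v_w by (auto simp: a_def b_def zero_less_mult_iff zero_less_divide_iff divide_less_0_iff)
qed

text \<open>After division by \<open>\<tau> ^ k\<close> the \<open>v\<close>-component of the orbit
  is constant and the \<open>w\<close>-component tends to 0. So does the remaining component, since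
  its orbit is bounded.\<close>

lemma funpow_asymptotics:
  "(\<lambda>k. B ((f ^^ k) x) r / \<tau> ^ k) \<longlonglongrightarrow> B x w * B v r / B v w"
proof -
  obtain n where x: "x = (B x w / B v w) *\<^sub>R v + (B x v / B v w) *\<^sub>R w + n"
      and n: "B n v = 0" "B n w = 0"
    using isotropic_decomposition by blast
  define a b where "a = B x w / B v w" and "b = B x v / B v w"
  define q where "q = inverse \<tau>"
  have q: "\<bar>q\<bar> < 1" "\<tau> ^ k * q ^ k = 1" for k
    using tau by (simp_all add: q_def inverse_less_1_iff flip: power_mult_distrib)
  have q0: "(\<lambda>k. q ^ k) \<longlonglongrightarrow> 0" using q(1) by (simp add: LIMSEQ_power_zero)
  have perp0: "(\<lambda>k. B ((f ^^ k) n) r * q ^ k) \<longlonglongrightarrow> 0"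
  proof -
    \<comment> \<open>The orbit of \<open>n\<close> keeps its square and stays orthogonal to
      \<open>v + w\<close>, so the compactness bound for a single point contains all of it.\<close>
    have "bounded {y. \<exists>x\<in>{v + w}. B x y = 0 \<and> B y y \<ge> B n n}"
      by (rule bounded_perp_to_compact) (use square_v_plus_w in auto)
    moreover have "(f ^^ k) n \<in> {y. \<exists>x\<in>{v + w}. B x y = 0 \<and> B y y \<ge> B n n}" for k
    proof -
      have "B ((f ^^ k) v) ((f ^^ k) n) = 0" "B ((f ^^ k) w) ((f ^^ k) n) = 0"
        using n by (auto simp: funpow_isometry sym[of v n] sym[of w n])
      then show ?thesis using tau by (simp add: funpow_v funpow_w B_simps funpow_isometry)
    qed
    ultimately obtain C where C: "\<And>k. norm ((f ^^ k) n) \<le> C"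
      unfolding bounded_iff by blast
    have "bounded_linear (\<lambda>y. B y r)" using linear_left by (simp add: linear_conv_bounded_linear)
    from bounded_linear.pos_bounded[OF this]
    obtain K where K: "\<And>y. norm (B y r) \<le> norm y * K" "K > 0"
      by auto
    have dominated: "norm (B ((f ^^ k) n) r * q ^ k) \<le> C * K * \<bar>q\<bar> ^ k" for k
    proof -
      have "norm (B ((f ^^ k) n) r) \<le> C * K"
        using K(1)[of "(f ^^ k) n"] mult_right_mono[OF C[of k], of K] K(2) by linarith
      then show ?thesis by (simp add: abs_mult power_abs mult_right_mono)
    qed
    have "(\<lambda>k. C * K * \<bar>q\<bar> ^ k) \<longlonglongrightarrow> C * K * 0"
      using q(1) by (intro tendsto_mult[OF tendsto_const] LIMSEQ_power_zero) simp
    then have "(\<lambda>k. C * K * \<bar>q\<bar> ^ k) \<longlonglongrightarrow> 0" by simp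
    then show ?thesis
      by (rule Lim_null_comparison[OF always_eventually[OF allI[OF dominated]]])
  qed
  have "B ((f ^^ k) x) r / \<tau> ^ k = a * B v r + b * B w r * (q ^ k * q ^ k) + B ((f ^^ k) n) r * q ^ k" for k
  proof -
    have "(f ^^ k) x = (f ^^ k) (a *\<^sub>R v + b *\<^sub>R w + n)"
      using x by (simp add: a_def b_def)
    also have "\<dots> = (a * \<tau> ^ k) *\<^sub>R v + (b * q ^ k) *\<^sub>R w + (f ^^ k) n"
      using linear_funpow[of k] by (simp add: linear_add linear_cmul funpow_v funpow_w q_def)
    finally have "B ((f ^^ k) x) r = a * \<tau> ^ k * B v r + b * q ^ k * B w r + B ((f ^^ k) n) r"
      by (simp add: B_simps)
    moreover have "1 / \<tau> ^ k = q ^ k" by (simp add: q_def inverse_eq_divide power_one_over)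
    ultimately have "B ((f ^^ k) x) r / \<tau> ^ k
        = (a * \<tau> ^ k * B v r + b * q ^ k * B w r + B ((f ^^ k) n) r) * q ^ k"
      by (metis mult.right_neutral times_divide_eq_right)
    also have "\<dots> = (\<tau> ^ k * q ^ k) * (a * B v r) + b * B w r * (q ^ k * q ^ k)
        + B ((f ^^ k) n) r * q ^ k"
      by algebra
    finally show ?thesis using q(2)[of k] by simp
  qed
  moreover have "(\<lambda>k. a * B v r + b * B w r * (q ^ k * q ^ k) + B ((f ^^ k) n) r * q ^ k)
      \<longlonglongrightarrow> a * B v r + b * B w r * (0 * 0) + 0"
    by (intro tendsto_add tendsto_mult tendsto_const q0 perp0)
  ultimately show ?thesis by (simp add: a_def)
qed

lemma sign_limit:
  assumes "\<And>k. B r x * B ((g ^^ k) r) x > 0"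
  shows "B r x * (B x w * B r v) \<ge> 0"
proof -
  have "B r x * (B ((f ^^ k) x) r / \<tau> ^ k) \<ge> 0" for k
  proof -
    have "B ((g ^^ k) r) x = B ((f ^^ k) x) r"
      using funpow_adjoint[of k x r] sym by metis
    then have "B r x * B ((f ^^ k) x) r > 0" using assms[of k] by simp
    then have "B r x * B ((f ^^ k) x) r / \<tau> ^ k \<ge> 0" using tau by (intro divide_nonneg_nonneg) auto
    then show ?thesis by simp
  qed
  then have "B r x * (B x w * B v r / B v w) \<ge> 0"
    by (intro LIMSEQ_le_const[OF tendsto_mult[OF tendsto_const funpow_asymptotics]]) auto
  then show ?thesis using v_w sym[of v r]
    by (auto simp: zero_le_divide_iff)
qed

text \<open>Multiply the limits for both time directions. The product is
  \<open>B r v * B r w\<close> times a square and \<open>B x v * B x w\<close>, which is positive by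
  \<open>mult_v_w_pos\<close>.\<close>

lemma same_sign_v_w:
  assumes "B x x > 0"
    and f: "\<And>k. B r x * B ((f ^^ k) r) x > 0" and g: "\<And>k. B r x * B ((g ^^ k) r) x > 0"
  shows "B r v * B r w \<ge> 0"
proof -
  have "B r x * (B x w * B r v) \<ge> 0" by (rule sign_limit[OF g])
  moreover have "B r x * (B x v * B r w) \<ge> 0"
    by (rule hyperbolic_isometry.sign_limit[OF inverse_isometry f])
  ultimately have "(B r x * (B x w * B r v)) * (B r x * (B x v * B r w)) \<ge> 0"
    by (rule mult_nonneg_nonneg)
  then have "((B r x)\<^sup>2 * (B x v * B x w)) * (B r v * B r w) \<ge> 0"
    by (simp add: power2_eq_square mult_ac)
  moreover have "B r x \<noteq> 0" using f[of 0] by auto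
  then have "(B r x)\<^sup>2 * (B x v * B x w) > 0"
    using mult_v_w_pos[OF assms(1)] by simp
  ultimately show ?thesis by (simp add: zero_le_mult_iff)
qed

lemma orbit_same_sign:
  assumes "\<And>k. B ((g ^^ k) r) x * B (g ((g ^^ k) r)) x > 0"
  shows "B r x * B ((g ^^ k) r) x > 0"
proof (induction k)
  case 0
  show ?case using assms[of 0] by (auto simp: zero_less_mult_iff)
next
  case (Suc k)
  then show ?case using assms[of k] by (auto simp: zero_less_mult_iff)
qed

end

section \<open>Lattice roots and the finiteness claims\<close>

locale hyperbolic_lattice_isometry = hyperbolic_isometry B f g \<tau> v w
  for B :: "'a::euclidean_space \<Rightarrow> 'a \<Rightarrow> real" and f g \<tau> v w +
  fixes L P :: "'a set"
  assumes finite_lattice_Int_bounded: "bounded X \<Longrightarrow> finite (L \<inter> X)"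
    and f_lattice: "x \<in> L \<Longrightarrow> f x \<in> L" and g_lattice: "x \<in> L \<Longrightarrow> g x \<in> L"
    and cone: "positive_cone B P"
    and f_cone: "x \<in> P \<Longrightarrow> f x \<in> P" and g_cone: "x \<in> P \<Longrightarrow> g x \<in> P"
    and v_plus_w_cone: "v + w \<in> P"
begin

lemma cone_positive: "x \<in> P \<Longrightarrow> B x x > 0"
  using in_components_subset cone unfolding positive_cone_def by blast

lemma f_roots: "r \<in> roots L B \<Longrightarrow> f r \<in> roots L B"
  by (simp add: roots_def f_lattice f_isometry)

lemma g_roots: "r \<in> roots L B \<Longrightarrow> g r \<in> roots L B"
  using hyperbolic_isometry.f_isometry[OF inverse_isometry] by (simp add: roots_def g_lattice)

lemma funpow_f_roots: "r \<in> roots L B \<Longrightarrow> (f ^^ k) r \<in> roots L B"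
  by (induction k) (auto intro: f_roots)

lemma funpow_g_roots: "r \<in> roots L B \<Longrightarrow> (g ^^ k) r \<in> roots L B"
  by (induction k) (auto intro: g_roots)

lemma finite_roots_meeting_compact:
  assumes "compact K" "\<And>x. x \<in> K \<Longrightarrow> B x x > 0"
  shows "finite {r \<in> roots L B. \<exists>x\<in>K. B r x = 0}"
proof (rule finite_subset)
  let ?X = "{y. \<exists>x\<in>K. B x y = 0 \<and> B y y \<ge> -2}"
  show "{r \<in> roots L B. \<exists>x\<in>K. B r x = 0} \<subseteq> L \<inter> ?X"
    by (auto simp: roots_def) (metis sym)
  show "finite (L \<inter> ?X)"
    using assms by (intro finite_lattice_Int_bounded bounded_perp_to_compact)
qed

text \<open>Pairing the vanishing orbit sum with an eigenvector gives a geometric sum with positive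
  terms times \<open>B r v\<close> or \<open>B r w\<close>, so the latter is 0.\<close>

lemma cyclic_roots_perp:
  assumes "r \<in> cyclic_roots L B f"
  shows "r \<in> roots L B" "B r v = 0" "B r w = 0"
proof -
  obtain i where r: "r \<in> L" "B r r = -2" and i: "(\<Sum>k=0..i. (f ^^ k) r) = 0"
    using assms unfolding cyclic_roots_def by blast
  show "r \<in> roots L B" using r by (simp add: roots_def)
  have "(\<Sum>k=0..i. inverse \<tau> ^ k) * B r v = (\<Sum>k=0..i. B ((f ^^ k) r) v)"
    by (simp add: sum_distrib_right funpow_image_v)
  also have "\<dots> = B (\<Sum>k=0..i. (f ^^ k) r) v" by (simp add: linear_sum[OF linear_left])
  finally have "(\<Sum>k=0..i. inverse \<tau> ^ k) * B r v = 0" by (simp add: i B_simps)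
  moreover have "(\<Sum>k=0..i. inverse \<tau> ^ k) > 0" using tau by (intro sum_pos) auto
  ultimately show "B r v = 0" by simp
  have "B ((f ^^ k) r) w = \<tau> ^ k * B r w" for k by (induction k) (simp_all add: f_image_w)
  then have "(\<Sum>k=0..i. \<tau> ^ k) * B r w = (\<Sum>k=0..i. B ((f ^^ k) r) w)"
    by (simp add: sum_distrib_right)
  also have "\<dots> = B (\<Sum>k=0..i. (f ^^ k) r) w" by (simp add: linear_sum[OF linear_left])
  finally have "(\<Sum>k=0..i. \<tau> ^ k) * B r w = 0" by (simp add: i B_simps)
  moreover have "(\<Sum>k=0..i. \<tau> ^ k) > 0" using tau by (intro sum_pos) auto
  ultimately show "B r w = 0" by simp
qed

lemma finite_cyclic_roots: "finite (cyclic_roots L B f)"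
proof (rule finite_subset)
  show "cyclic_roots L B f \<subseteq> {r \<in> roots L B. \<exists>x\<in>{v + w}. B r x = 0}"
    using cyclic_roots_perp by (auto simp: B_simps)
  show "finite {r \<in> roots L B. \<exists>x\<in>{v + w}. B r x = 0}"
    using square_v_plus_w by (intro finite_roots_meeting_compact) auto
qed

lemma finite_orthogonal_roots:
  assumes "B h h > 0"
  shows "finite (orthogonal_roots L B h)"
proof -
  have "orthogonal_roots L B h = {r \<in> roots L B. \<exists>x\<in>{h}. B r x = 0}"
    by (auto simp: orthogonal_roots_def roots_def)
  then show ?thesis using finite_roots_meeting_compact[of "{h}"] assms by simp
qed

text \<open>The cone \<open>P\<close> is convex and preserved by \<open>f\<close>. If
  \<open>h\<close> lies in the opposite cone, the argument applies to \<open>- h\<close>.\<close>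

lemma segment_positive:
  assumes "B h h > 0" "x \<in> closed_segment h (f h)"
  shows "B x x > 0"
proof -
  have *: "closed_segment y (f y) \<subseteq> P" if "y \<in> P" for y
    using closed_segment_subset that f_cone convex_positive_cone[OF cone] by blast
  show ?thesis
  proof (cases "h \<in> P")
    case True
    then show ?thesis using * assms(2) cone_positive by blast
  next
    case False
    then have h: "- h \<in> P" using positive_cone_cases[OF cone assms(1)] by blast
    obtain t where t: "0 \<le> t" "t \<le> 1" "x = (1 - t) *\<^sub>R h + t *\<^sub>R f h"
      using assms(2) by (auto simp: in_segment)
    then have "- x = (1 - t) *\<^sub>R (- h) + t *\<^sub>R f (- h)"
      by (simp add: linear_neg[OF linear_f])
    then have "- x \<in> closed_segment (- h) (f (- h))" using t unfolding in_segment by blast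
    then have "B (- x) (- x) > 0" using *[OF h] cone_positive by blast
    then show ?thesis by (simp add: B_simps)
  qed
qed

lemma finite_separating_roots:
  assumes "B h h > 0"
  shows "finite (separating_roots L B f h)"
proof (rule finite_subset)
  let ?K = "closed_segment h (f h)"
  show "separating_roots L B f h \<subseteq> {r \<in> roots L B. \<exists>x\<in>?K. B r x = 0}"
  proof
    fix r assume r: "r \<in> separating_roots L B f h"
    have "\<exists>x\<in>?K. B r x = 0"
    proof (rule ccontr)
      assume "\<not> (\<exists>x\<in>?K. B r x = 0)"
      then have "B r h * B r (f h) > 0"
        by (intro connected_nonvanishing_same_sign[OF linear_right, of ?K]) auto
      then show False using r by (simp add: separating_roots_def)
    qed
    then show "r \<in> {r \<in> roots L B. \<exists>x\<in>?K. B r x = 0}"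
      using r by (simp add: separating_roots_def roots_def)
  qed
  show "finite {r \<in> roots L B. \<exists>x\<in>?K. B r x = 0}"
    using segment_positive[OF assms] by (intro finite_roots_meeting_compact) auto
qed

section \<open>Consequences of an invariant chamber, and reduction to the roots at
  \<open>h\<close>\<close>

definition "complement = P - (\<Union>r\<in>roots L B. root_hyperplane B r)"

lemma complement_iff: "x \<in> complement \<longleftrightarrow> x \<in> P \<and> (\<forall>r\<in>roots L B. B r x \<noteq> 0)"
  by (auto simp: complement_def root_hyperplane_def sym)

lemma f_complement: "x \<in> complement \<Longrightarrow> f x \<in> complement"
  using f_adjoint[of x] g_roots sym unfolding complement_iff by (metis f_cone)

lemma g_complement: "x \<in> complement \<Longrightarrow> g x \<in> complement"
  using f_adjoint[of _ x] f_roots sym unfolding complement_iff by (metis g_cone)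

text \<open>The whole orbit of \<open>x\<close> stays in the connected set \<open>M\<close>, where
  \<open>r\<close> never vanishes. Adjointness trades the orbit of \<open>x\<close> for that of
  \<open>r\<close>.\<close>

lemma invariant_chamber_same_sign:
  assumes M: "M \<in> chambers L B P" "f ` M = M" and x: "x \<in> M" and r: "r \<in> roots L B"
  shows "B r x * B ((f ^^ k) r) x > 0" "B r x * B ((g ^^ k) r) x > 0"
proof -
  have comp: "M \<in> components complement" using M(1) by (simp add: chambers_def complement_def)
  have nz: "B r y \<noteq> 0" if "y \<in> M" for y
    using in_components_subset[OF comp] that r complement_iff by blast
  have pos: "B r x * B r y > 0" if "y \<in> M" for y
    using in_components_connected[OF comp] nz x that
    by (intro connected_nonvanishing_same_sign[OF linear_right])
  have fM: "f y \<in> M" if "y \<in> M" for y using M(2) that by blast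
  have gM: "g y \<in> M" if "y \<in> M" for y using M(2) that by (metis g_f imageE)
  have "(f ^^ k) x \<in> M" "(g ^^ k) x \<in> M" by (induction k) (use x fM gM in auto)
  then show "B r x * B ((f ^^ k) r) x > 0" "B r x * B ((g ^^ k) r) x > 0"
    using pos funpow_adjoint[of k] hyperbolic_isometry.funpow_adjoint[OF inverse_isometry, of k]
    by metis+
qed

lemma invariant_chamber_imp:
  assumes M: "M \<in> chambers L B P" "f ` M = M"
  shows "cyclic_roots L B f = {}" "r \<in> roots L B \<Longrightarrow> B r v * B r w \<ge> 0"
proof -
  obtain x where x: "x \<in> M" using M(1) in_components_nonempty unfolding chambers_def by blast
  have "x \<in> P" using M(1) x in_components_subset unfolding chambers_def by blast
  then have xx: "B x x > 0" by (rule cone_positive)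
  show "cyclic_roots L B f = {}"
  proof (rule equals0I)
    fix r assume r: "r \<in> cyclic_roots L B f"
    then obtain i where i: "(\<Sum>k=0..i. (f ^^ k) r) = 0" by (auto simp: cyclic_roots_def)
    \<comment> \<open>All members of the orbit of \<open>r\<close> have the same sign at
      \<open>x\<close>, so their sum cannot be 0.\<close>
    have "(\<Sum>k=0..i. B r x * B ((f ^^ k) r) x) > 0"
      using invariant_chamber_same_sign(1)[OF M x cyclic_roots_perp(1)[OF r]] by (intro sum_pos) auto
    also have "(\<Sum>k=0..i. B r x * B ((f ^^ k) r) x) = B r x * B (\<Sum>k=0..i. (f ^^ k) r) x"
      by (simp add: sum_distrib_left linear_sum[OF linear_left])
    finally show False by (simp add: i B_simps)
  qed
  show "B r v * B r w \<ge> 0" if "r \<in> roots L B"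
    using invariant_chamber_same_sign[OF M x that] by (rule same_sign_v_w[OF xx])
qed

text \<open>The factors \<open>\<tau>\<close> and \<open>inverse \<tau>\<close> cancel, so
  \<open>B r v * B r w\<close> is constant along the orbit of \<open>r\<close>. If it were negative,
  the orbit would avoid both finite sets and never change sign at \<open>h\<close>, contradicting
  \<open>same_sign_v_w\<close>.\<close>

lemma root_sign_condition:
  assumes h: "B h h > 0"
    and cond: "\<And>r. r \<in> orthogonal_roots L B h \<union> separating_roots L B f h \<Longrightarrow> B r v * B r w \<ge> 0"
    and r: "r \<in> roots L B"
  shows "B r v * B r w \<ge> 0"
proof (rule ccontr)
  assume neg: "\<not> B r v * B r w \<ge> 0"
  have f_inv: "B (f s) v * B (f s) w = B s v * B s w" for s
    using tau by (simp add: f_image_v f_image_w)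
  then have g_inv: "B (g s) v * B (g s) w = B s v * B s w" for s using f_inv[of "g s"] by simp
  have step: "B s h * B (g s) h > 0"
    if s: "s \<in> roots L B" "B s v * B s w = B r v * B r w" for s
  proof -
    have "s \<notin> orthogonal_roots L B h" "s \<notin> separating_roots L B f h"
      using cond[of s] s neg by auto
    then have "B s h \<noteq> 0" "B s h * B s (f h) \<ge> 0"
      using s by (auto simp: orthogonal_roots_def separating_roots_def roots_def)
    \<comment> \<open>Not separating only says that the product is not negative; strictness needs
      that \<open>g s\<close> too is nonzero at \<open>h\<close>.\<close>
    moreover have "g s \<notin> orthogonal_roots L B h"
      using cond[of "g s"] s neg by (auto simp: g_inv)
    then have "B (g s) h \<noteq> 0"
      using g_roots[OF s(1)] by (auto simp: orthogonal_roots_def roots_def)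
    moreover have "B s (f h) = B (g s) h" using f_adjoint[of h s] sym by metis
    ultimately show ?thesis by (simp add: less_le)
  qed
  have pow: "B ((f ^^ k) r) v * B ((f ^^ k) r) w = B r v * B r w"
      "B ((g ^^ k) r) v * B ((g ^^ k) r) w = B r v * B r w" for k
    by (induction k) (simp_all add: f_inv g_inv)
  have "B r h * B ((g ^^ k) r) h > 0" for k
    by (rule orbit_same_sign) (intro step funpow_g_roots r pow)
  moreover have "B r h * B ((f ^^ k) r) h > 0" for k
  proof (rule hyperbolic_isometry.orbit_same_sign[OF inverse_isometry])
    show "B ((f ^^ j) r) h * B (f ((f ^^ j) r)) h > 0" for j
      using step[OF funpow_f_roots[OF r] pow(1), of "Suc j"] by (simp add: mult.commute)
  qed
  ultimately have "B r v * B r w \<ge> 0" by (intro same_sign_v_w[OF h])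
  then show False using neg by simp
qed

section \<open>Construction of an invariant chamber\<close>

text \<open>Since \<open>B (f r) x = B r (g x)\<close>, the hypothesis says that no root hyperplane
  separates \<open>x\<close> from \<open>g x\<close>. The segment between them therefore lies in one
  chamber, which meets its images under \<open>f\<close> and \<open>g\<close>.\<close>

lemma same_sign_imp_invariant_chamber:
  assumes x: "x \<in> P" and same: "\<And>r. r \<in> roots L B \<Longrightarrow> B r x * B (f r) x > 0"
  shows "\<exists>M\<in>chambers L B P. f ` M = M"
proof -
  have fr: "B (f r) x = B r (g x)" for r by (rule f_adjoint)
  have seg: "closed_segment x (g x) \<subseteq> complement"
  proof
    fix z assume z: "z \<in> closed_segment x (g x)"
    have "z \<in> P"
      using closed_segment_subset[OF x g_cone[OF x] convex_positive_cone[OF cone]] z by blast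
    moreover have "B r z \<noteq> 0" if "r \<in> roots L B" for r
    proof -
      obtain t where t: "0 \<le> t" "t \<le> 1" "z = (1 - t) *\<^sub>R x + t *\<^sub>R g x"
        using z by (auto simp: in_segment)
      have "B r x * B r z = (1 - t) * (B r x)\<^sup>2 + t * (B r x * B r (g x))"
        by (simp add: t(3) B_simps power2_eq_square algebra_simps)
      moreover have "B r x * B r (g x) > 0" using same[OF that] fr by simp
      moreover have "(B r x)\<^sup>2 > 0" using same[OF that] by auto
      ultimately have "B r x * B r z > 0"
        using t(1,2) by (cases "t = 0") (auto intro: add_nonneg_pos)
      then show ?thesis by auto
    qed
    ultimately show "z \<in> complement" by (simp add: complement_iff)
  qed
  define M where "M = connected_component_set complement x"
  have comp: "M \<in> components complement" using seg unfolding M_def by (intro componentsI) auto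
  have xM: "x \<in> M" and gxM: "g x \<in> M"
    using connected_component_maximal[of x "closed_segment x (g x)" complement] seg
    by (auto simp: M_def)
  have cont: "continuous_on M f" "continuous_on M g"
    using linear_f linear_g by (simp_all add: linear_continuous_on linear_conv_bounded_linear)
  have sub: "M \<subseteq> complement" using comp by (rule in_components_subset)
  have con: "connected M" using comp by (rule in_components_connected)
  have "f ` M \<subseteq> M"
  proof (rule components_maximal[OF comp])
    show "connected (f ` M)" using cont(1) con by (rule connected_continuous_image)
    show "f ` M \<subseteq> complement" using sub f_complement by blast
    \<comment> \<open>The common point is \<open>x = f (g x)\<close>.\<close>
    show "M \<inter> f ` M \<noteq> {}" using xM gxM f_g by (metis IntI emptyE imageI)
  qed
  moreover have "g ` M \<subseteq> M"
  proof (rule components_maximal[OF comp])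
    show "connected (g ` M)" using cont(2) con by (rule connected_continuous_image)
    show "g ` M \<subseteq> complement" using sub g_complement by blast
    show "M \<inter> g ` M \<noteq> {}" using xM gxM by blast
  qed
  then have "M \<subseteq> f ` M" by (metis f_g image_eqI image_subset_iff subsetI)
  ultimately have "f ` M = M" by blast
  then show ?thesis using comp by (auto simp: chambers_def complement_def)
qed

text \<open>Averaging a generic vector over the common period of the roots orthogonal to \<open>v\<close> and \<open>w\<close>
  turns the nonvanishing of all orbit sums into nonvanishing on those roots.\<close>

lemma invariant_generic_functional:
  assumes cyclic: "cyclic_roots L B f = {}"
    and \<Phi>: "\<Phi> = {r \<in> roots L B. B r v = 0 \<and> B r w = 0}"
  shows "\<exists>y. \<forall>r\<in>\<Phi>. B r y \<noteq> 0 \<and> B (f r) y = B r y"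
proof -
  have perp: "B r (v + w) = 0" if "r \<in> \<Phi>" for r using that by (simp add: \<Phi> B_simps)
  have "finite {r \<in> roots L B. \<exists>x\<in>{v + w}. B r x = 0}"
    using square_v_plus_w by (intro finite_roots_meeting_compact) auto
  then have fin: "finite \<Phi>" by (rule rev_finite_subset) (auto simp: \<Phi> B_simps)
  have inv: "f ` \<Phi> \<subseteq> \<Phi>" by (auto simp: \<Phi> f_roots f_image_v f_image_w)
  have "inj f" by (metis injI g_f)
  then obtain m where m: "m > 0" "\<And>r. r \<in> \<Phi> \<Longrightarrow> (f ^^ m) r = r"
    using common_period[OF _ fin inv] by blast
  define S where "S r = (\<Sum>k<m. (f ^^ k) r)" for r
  have S_f: "S (f r) = S r" if "r \<in> \<Phi>" for r
  proof -
    have "S (f r) = (\<Sum>k<m. (f ^^ Suc k) r)" by (simp add: S_def funpow_swap1)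
    also have "r + \<dots> = (\<Sum>k<Suc m. (f ^^ k) r)"
      by (subst sum.lessThan_Suc_shift) simp
    also have "\<dots> = S r + r" by (simp add: S_def m(2)[OF that])
    finally show ?thesis by simp
  qed
  have S_nz: "S r \<noteq> 0" if "r \<in> \<Phi>" for r
  proof -
    have r: "r \<in> L" "B r r = -2" using that by (auto simp: \<Phi> roots_def)
    obtain i where i: "m = Suc i" using m(1) gr0_implies_Suc by blast
    show ?thesis
    \<comment> \<open>\<open>cyclic_roots\<close> asks for \<open>i \<ge> 1\<close>, so period 1 is
      treated apart: there the orbit sum is the root itself.\<close>
    proof (cases "i = 0")
      case True
      then show ?thesis using r by (auto simp: S_def i B_simps)
    next
      case False
      have "{..<m} = {0..i}" by (auto simp: i)
      then show ?thesis using cyclic False r by (auto simp: S_def cyclic_roots_def)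
    qed
  qed
  have "\<exists>z. B (S r) z \<noteq> 0" if "r \<in> \<Phi>" for r
  proof
    have "(f ^^ k) r \<in> \<Phi>" for k using inv that by (induction k) auto
    then have "B (S r) (v + w) = 0" by (simp add: S_def linear_sum[OF linear_left] perp)
    \<comment> \<open>The orbit sum is its own witness: it is nonzero and orthogonal to
      \<open>v + w\<close>, hence of negative square.\<close>
    then show "B (S r) (S r) \<noteq> 0"
      using perp_negative[OF square_v_plus_w _ S_nz[OF that]] by fastforce
  qed
  then obtain z where z: "\<forall>r\<in>\<Phi>. B (S r) z \<noteq> 0"
    using avoid_finitely_many_hyperplanes[OF fin, of "\<lambda>r. B (S r)"] linear_right by blast
  \<comment> \<open>Adjointness moves the orbit sum from \<open>r\<close> to \<open>z\<close>, so
    \<open>y\<close> sees only \<open>S r\<close>, which is the same for \<open>r\<close> and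
    \<open>f r\<close>.\<close>
  define y where "y = (\<Sum>k<m. (g ^^ k) z)"
  have "B r y = B (S r) z" for r
    by (simp add: y_def S_def linear_sum[OF linear_left] linear_sum[OF linear_right] funpow_adjoint)
  then show ?thesis by (intro exI[of _ y] ballI) (simp add: z S_f)
qed

text \<open>A root nonzero at \<open>u = v + w\<close> has the same sign there as its image under
  \<open>f\<close>, and a small perturbation keeps both signs. For roots vanishing at
  \<open>u\<close>, the perturbing vector \<open>y\<close> supplies equal nonzero values.\<close>

lemma invariant_chamber_exists:
  assumes cyclic: "cyclic_roots L B f = {}"
    and sign: "\<And>r. r \<in> roots L B \<Longrightarrow> B r v * B r w \<ge> 0"
  shows "\<exists>M\<in>chambers L B P. f ` M = M"
proof -
  define u where "u = v + w"
  define \<Phi> where "\<Phi> = {r \<in> roots L B. B r v = 0 \<and> B r w = 0}"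
  obtain y where y: "\<And>r. r \<in> \<Phi> \<Longrightarrow> B r y \<noteq> 0 \<and> B (f r) y = B r y"
    using invariant_generic_functional[OF cyclic \<Phi>_def] by blast
  \<comment> \<open>By the sign condition, the values of \<open>r\<close> at \<open>v\<close> and
    \<open>w\<close> can cancel only if both are 0.\<close>
  have \<Phi>_iff: "r \<in> \<Phi> \<longleftrightarrow> B r u = 0" if "r \<in> roots L B" for r
  proof -
    have "B r v = 0 \<and> B r w = 0" if "B r v + B r w = 0"
    proof -
      have "B r w = - B r v" using that by simp
      then have "B r v * B r v \<le> 0" using sign[OF \<open>r \<in> roots L B\<close>] by simp
      then have "B r v = 0" by (metis mult_eq_0_iff zero_le_square order_antisym)
      then show ?thesis using that by simp
    qed
    then show ?thesis using that by (auto simp: \<Phi>_def u_def B_simps)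
  qed
  have "open {x. 0 < B x x}"
    by (intro open_Collect_less continuous_intros)
  then have "open P" using cone unfolding positive_cone_def by (rule open_components)
  then obtain d where d: "d > 0" "cball u d \<subseteq> P"
    using v_plus_w_cone unfolding u_def open_contains_cball by blast
  \<comment> \<open>Roots outside \<open>F\<close> keep their sign on the connected ball around
    \<open>u\<close>, so only finitely many roots restrict \<open>e\<close>.\<close>
  define F where "F = {r \<in> roots L B. \<exists>x\<in>cball u d. B r x = 0}"
  have "finite F" unfolding F_def
    using d cone_positive by (intro finite_roots_meeting_compact) auto
  have lim: "((\<lambda>e. u + e *\<^sub>R y) \<longlongrightarrow> u) (at_right 0)"
    by (rule tendsto_eq_intros refl tendsto_ident_at | simp)+
  have "\<forall>\<^sub>F e in at_right 0. u + e *\<^sub>R y \<in> ball u d"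
    using topological_tendstoD[OF lim, of "ball u d"] d(1) by simp
  moreover have "\<forall>\<^sub>F e in at_right 0. \<forall>r\<in>F. B r u \<noteq> 0 \<longrightarrow> B r u * B r (u + e *\<^sub>R y) > 0"
  proof (intro eventually_ball_finite \<open>finite F\<close> ballI)
    fix r
    show "\<forall>\<^sub>F e in at_right 0. B r u \<noteq> 0 \<longrightarrow> B r u * B r (u + e *\<^sub>R y) > 0"
    proof (cases "B r u = 0")
      case False
      have "((\<lambda>e. B r u * (B r u + e * B r y)) \<longlongrightarrow> B r u * (B r u + 0 * B r y)) (at_right 0)"
        by (intro tendsto_intros)
      then have "\<forall>\<^sub>F e in at_right 0. 0 < B r u * (B r u + e * B r y)"
        by (rule order_tendstoD(1)) (use False in \<open>auto simp: zero_less_mult_iff\<close>)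
      then show ?thesis by (rule eventually_mono) (simp add: B_simps)
    qed simp
  qed
  moreover have "\<forall>\<^sub>F e in at_right (0::real). e > 0" by (rule eventually_at_right_less)
  ultimately have "\<forall>\<^sub>F e in at_right 0. u + e *\<^sub>R y \<in> ball u d \<and>
      (\<forall>r\<in>F. B r u \<noteq> 0 \<longrightarrow> B r u * B r (u + e *\<^sub>R y) > 0) \<and> e > 0"
    by (intro eventually_conj)
  then obtain e where e: "u + e *\<^sub>R y \<in> ball u d" "e > 0"
      "\<And>r. r \<in> F \<Longrightarrow> B r u \<noteq> 0 \<Longrightarrow> B r u * B r (u + e *\<^sub>R y) > 0"
    using eventually_happens'[OF trivial_limit_at_right_real] by blast
  define x where "x = u + e *\<^sub>R y"
  have x: "x \<in> cball u d" using e(1) by (simp add: x_def)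
  have near: "B r u * B r x > 0" if "r \<in> roots L B" "B r u \<noteq> 0" for r
  proof (cases "r \<in> F")
    case True
    then show ?thesis using e(3) that by (simp add: x_def)
  next
    case False
    then have "B r z \<noteq> 0" if "z \<in> cball u d" for z
      using that \<open>r \<in> roots L B\<close> by (auto simp: F_def)
    then show ?thesis
      using d(1) x by (intro connected_nonvanishing_same_sign[OF linear_right, of "cball u d"]) auto
  qed
  show ?thesis
  proof (rule same_sign_imp_invariant_chamber)
    show "x \<in> P" using x d by blast
    fix r assume r: "r \<in> roots L B"
    show "B r x * B (f r) x > 0"
    proof (cases "B r u = 0")
      case True
      then have \<Phi>: "r \<in> \<Phi>" using \<Phi>_iff r by blast
      then have "B (f r) u = 0" by (simp add: \<Phi>_def u_def B_simps f_image_v f_image_w)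
      then have "B r x = e * B r y" "B (f r) x = e * B r y"
        using True y[OF \<Phi>] by (simp_all add: x_def B_simps)
      moreover have "(e * B r y)\<^sup>2 > 0" using y[OF \<Phi>] e(2) by simp
      ultimately show ?thesis by (simp add: power2_eq_square)
    next
      case False
      define a b where "a = B r v" and "b = B r w"
      have ab: "a * b \<ge> 0" "a + b \<noteq> 0"
        using sign[OF r] False by (auto simp: a_def b_def u_def B_simps)
      have "B r u * B (f r) u = (a + b) * (inverse \<tau> * a + \<tau> * b)"
        by (simp add: u_def B_simps f_image_v f_image_w a_def b_def)
      \<comment> \<open>Since \<open>a * b \<ge> 0\<close>, no term of this expansion is negative,
        and a square term is positive.\<close>
      also have "\<dots> = inverse \<tau> * (a * a) + \<tau> * (b * b) + (\<tau> + inverse \<tau>) * (a * b)"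
        by (simp add: algebra_simps)
      also have "\<dots> > 0"
      proof -
        have "a \<noteq> 0 \<or> b \<noteq> 0" using ab(2) by auto
        then have "inverse \<tau> * (a * a) > 0 \<or> \<tau> * (b * b) > 0"
          using tau by (auto simp: zero_less_mult_iff)
        moreover have "inverse \<tau> * (a * a) \<ge> 0" "\<tau> * (b * b) \<ge> 0" "(\<tau> + inverse \<tau>) * (a * b) \<ge> 0"
          using tau ab(1) by auto
        ultimately show ?thesis by linarith
      qed
      finally have *: "B r u * B (f r) u > 0" .
      then have "B (f r) u \<noteq> 0" by auto
      then have "B (f r) u * B (f r) x > 0" using near f_roots[OF r] by blast
      then show ?thesis using near[OF r False] * by (auto simp: zero_less_mult_iff)
    qed
  qed
qed

end

section \<open>From the lattice data to both claims\<close>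

theorem theorem5p6:
  fixes L :: "'a::euclidean_space set"
    and B :: "'a \<Rightarrow> 'a \<Rightarrow> real"
    and P :: "'a set"
    and f :: "'a \<Rightarrow> 'a"
    and \<tau> :: real
    and v w h :: 'a
  assumes "even_hyperbolic_lattice L B"
    and "positive_cone B P"
    and "f \<in> isometries_plus L B P"
    and "spectral_radius f = \<tau>" and "\<tau> > 1"
    and "v \<noteq> 0" and "w \<noteq> 0"
    and "f v = \<tau> *\<^sub>R v" and "f w = inverse \<tau> *\<^sub>R w"
    and "B v w > 0"
    and "h \<in> L" and "B h h > 0"
  shows "(finite (cyclic_roots L B f) \<and>
          finite (orthogonal_roots L B h) \<and>
          finite (separating_roots L B f h)) \<and>
         (positive_isometry L B P f \<longleftrightarrow>
            cyclic_roots L B f = {} \<and>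
            (\<forall>r \<in> orthogonal_roots L B h \<union> separating_roots L B f h. B r v * B r w \<ge> 0))"
proof -
  obtain S n where S: "finite S" "independent S" "span S = UNIV" "L = integer_span S"
      and bil: "bilinear B" and sym: "\<And>x y. B x y = B y x" and sig: "has_signature B 1 n"
    using assms(1) unfolding even_hyperbolic_lattice_def even_lattice_def is_lattice_def by metis
  interpret hyperbolic_form B using bil sym sig by (rule hyperbolic_formI)
  have lin: "linear f" and fL: "f ` L = L" and fP: "f ` P = P"
      and isoL: "\<And>x y. x \<in> L \<Longrightarrow> y \<in> L \<Longrightarrow> B (f x) (f y) = B x y"
    using assms(3) by (auto simp: isometries_plus_def isometries_def)
  have SL: "S \<subseteq> L" using subset_integer_span[OF S(1)] S(4) by simp
  \<comment> \<open>Isometry is given on \<open>L\<close> only. As \<open>L\<close> contains the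
    basis \<open>S\<close>, bilinearity extends it to the whole space.\<close>
  have iso: "B (f x) (f y) = B x y" for x y
  proof (rule bilinear_eq[of "\<lambda>x y. B (f x) (f y)" B UNIV S UNIV S])
    show "bilinear (\<lambda>x y. B (f x) (f y))"
      using lin bil linear_compose[OF lin linear_left] linear_compose[OF lin linear_right]
      by (simp add: bilinear_def o_def)
    show "B (f a) (f b) = B a b" if "a \<in> S" "b \<in> S" for a b
      using isoL SL that by blast
  qed (use bil S in auto)
  have "UNIV \<subseteq> f ` UNIV"
  proof -
    have "S \<subseteq> f ` UNIV" using SL fL by (metis image_mono subset_UNIV subset_trans)
    then have "span S \<subseteq> f ` UNIV"
      using span_minimal linear_subspace_image[OF lin subspace_UNIV] by blast
    then show ?thesis using S(3) by simp
  qed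
  then have surj: "surj f" by blast
  then have inj: "inj f" using linear_surj_imp_inj[OF lin] by blast
  obtain g where g: "linear g" "\<And>x. f (g x) = x" "\<And>x. g (f x) = x"
    using linear_injective_isomorphism[OF lin inj] by blast
  have gL: "g x \<in> L" if "x \<in> L" for x using fL g(3) that by (metis imageE)
  have gP: "g x \<in> P" if "x \<in> P" for x using fP g(3) that by (metis imageE)
  interpret hyperbolic_isometry B f g \<tau> v w
    by unfold_locales
      (use lin g iso assms(5,8-10) in \<open>auto simp: linear_add linear_cmul\<close>)
  \<comment> \<open>Either \<open>v + w\<close> or its negative lies in \<open>P\<close>. Changing
    the sign of both eigenvectors together preserves \<open>B v w\<close> and every product
    \<open>B r v * B r w\<close>.\<close>
  obtain c :: real where c: "c = 1 \<or> c = -1" "c *\<^sub>R v + c *\<^sub>R w \<in> P"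
    using positive_cone_cases[OF assms(2) square_v_plus_w]
    by (metis minus_add_distrib scaleR_minus1_left scaleR_one)
  have cc: "c * (c * z) = z" for z using c(1) by auto
  interpret hyperbolic_lattice_isometry B f g \<tau> "c *\<^sub>R v" "c *\<^sub>R w" L P
  proof (intro hyperbolic_lattice_isometry.intro hyperbolic_isometry.intro
      hyperbolic_isometry_axioms.intro hyperbolic_lattice_isometry_axioms.intro hyperbolic_form_axioms)
    show "finite (L \<inter> X)" if "bounded X" for X
      using finite_integer_span_Int_bounded[OF S(1,2) that] S(4) by simp
    show "f x \<in> L" if "x \<in> L" for x using fL that by blast
    show "f x \<in> P" if "x \<in> P" for x using fP that by blast
    show "B (c *\<^sub>R v) (c *\<^sub>R w) > 0" using assms(10) by (simp add: B_simps cc)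
  qed (use lin g iso assms gL gP c in \<open>auto simp: linear_cmul\<close>)
  have scale: "B r (c *\<^sub>R v) * B r (c *\<^sub>R w) = B r v * B r w" for r
    using c(1) by (auto simp: B_simps)
  have "positive_isometry L B P f \<longleftrightarrow> (\<exists>M\<in>chambers L B P. f ` M = M)"
    using assms(3) by (simp add: positive_isometry_def)
  also have "\<dots> \<longleftrightarrow> cyclic_roots L B f = {} \<and>
      (\<forall>r \<in> orthogonal_roots L B h \<union> separating_roots L B f h. B r v * B r w \<ge> 0)"
  proof
    assume "\<exists>M\<in>chambers L B P. f ` M = M"
    moreover have "orthogonal_roots L B h \<union> separating_roots L B f h \<subseteq> roots L B"
      by (auto simp: orthogonal_roots_def separating_roots_def roots_def)
    ultimately show "cyclic_roots L B f = {} \<and>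
        (\<forall>r \<in> orthogonal_roots L B h \<union> separating_roots L B f h. B r v * B r w \<ge> 0)"
      using invariant_chamber_imp scale by (metis subsetD)
  next
    assume "cyclic_roots L B f = {} \<and>
      (\<forall>r \<in> orthogonal_roots L B h \<union> separating_roots L B f h. B r v * B r w \<ge> 0)"
    then show "\<exists>M\<in>chambers L B P. f ` M = M"
      using invariant_chamber_exists root_sign_condition[OF assms(12)] scale by metis
  qed
  finally show ?thesis
    using finite_cyclic_roots finite_orthogonal_roots[OF assms(12)]
      finite_separating_roots[OF assms(12)] by blast
qed

end
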